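(* Let $f:[0,\infty)\to(0,\infty)$ be a differentiable mapping and let $a,b\in[0,\infty)$ with $a<b$. Let $m\in(0,1]$, $\mu>0$, $q>1$ and $0\le p\le q$. Suppose that $f'\in L[a,b]$, that $|f'|^{q}$ is $m$-logarithmically convex, and that $|f'(x)|^{q}\le M$. Then for every $x\in[a,b]$, $$\left|\frac{(x-a)^{\mu}+(b-x)^{\mu}}{b-a}f(x)-\frac{\Gamma(\mu+1)}{b-a}\left[J_{x^-}^{\mu}f(a)+J_{x^+}^{\mu}f(b)\right]\right|\le\left(\frac{q-1}{\mu(q-p)+q-1}\right)^{\frac{q-1}{q}}K_2^{\frac1q}\left[\frac{(x-a)^{\mu+1}+(b-x)^{\mu+1}}{b-a}\right],$$ where $$K_2=\begin{cases}\dfrac{M^{m}\left(\Gamma(\mu p+1)-\Gamma\left(\mu p+1,\ln M^{m-1}\right)\right)}{\left(\ln M^{m-1}\right)^{\mu p+1}}, & M<1,\\[2mm] \dfrac{1}{\mu p+1}, & M=1.\end{cases}$$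
   Context: For $m\in(0,1]$, a function $g:[0,\infty)\to(0,\infty)$ is $m$-logarithmically convex if $g(tx+m(1-t)y)\le [g(x)]^{t}[g(y)]^{m(1-t)}$ for all $x,y\in[0,\infty)$ and $t\in[0,1]$. $M$ is a constant, and the bound $|f'(x)|^q\le M$ is meant for all $x\in[0,\infty)$. Riemann-Liouville fractional integrals of order $\mu>0$: $J_{x^-}^{\mu}f(a)=\frac{1}{\Gamma(\mu)}\int_a^x (t-a)^{\mu-1}f(t)\,dt$ and $J_{x^+}^{\mu}f(b)=\frac{1}{\Gamma(\mu)}\int_x^b (b-t)^{\mu-1}f(t)\,dt$, where $\Gamma(s)$ is the Gamma function. $\Gamma(s,z)=\int_z^\infty e^{-u}u^{s-1}\,du$ is the upper incomplete Gamma function. $L[a,b]$ denotes the Lebesgue integrable functions on $[a,b]$.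
   Formalization: For m=1 and M<1 the printed K_2 is 0/0; there K_2 is taken to be its limit as m tends to 1 from below, M/(μp+1). M≤1 is made an explicit hypothesis, since K_2 is defined only for M<1 and M=1. *)

theory Defs
  imports "HOL-Analysis.Analysis"
begin

text \<open>Functions on \<open>[0, \<infinity>)\<close> are total functions of which only the values at
  nonnegative arguments are constrained.\<close>

definition m_log_convex :: "real \<Rightarrow> (real \<Rightarrow> real) \<Rightarrow> bool" where
  "m_log_convex m g \<longleftrightarrow>
     (\<forall>x\<ge>0. g x > 0) \<and>
     (\<forall>x\<ge>0. \<forall>y\<ge>0. \<forall>t\<in>{0..1}.
        g (t * x + m * (1 - t) * y) \<le> g x powr t * g y powr (m * (1 - t)))"

text \<open>The Riemann-Liouville integrals \<open>J\<^bsub>x-\<^esub>\<^sup>\<mu> f(a)\<close> and \<open>J\<^bsub>x+\<^esub>\<^sup>\<mu> f(b)\<close>: the point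
  \<open>x\<close> is the fixed end of the integration range, the last argument is the point of evaluation.\<close>

definition RL_minus :: "real \<Rightarrow> real \<Rightarrow> (real \<Rightarrow> real) \<Rightarrow> real \<Rightarrow> real" where
  "RL_minus \<mu> x f a =
     1 / Gamma \<mu> * (LINT t:{a..x}|lebesgue. (t - a) powr (\<mu> - 1) * f t)"

definition RL_plus :: "real \<Rightarrow> real \<Rightarrow> (real \<Rightarrow> real) \<Rightarrow> real \<Rightarrow> real" where
  "RL_plus \<mu> x f b =
     1 / Gamma \<mu> * (LINT t:{x..b}|lebesgue. (b - t) powr (\<mu> - 1) * f t)"

definition upper_Gamma :: "real \<Rightarrow> real \<Rightarrow> real" where
  "upper_Gamma s z = (LINT u:{z..}|lebesgue. exp (- u) * u powr (s - 1))"

text \<open>The formula for \<open>M < 1\<close> reads \<open>0 / 0\<close> when \<open>m = 1\<close>. There it is replaced by its limit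
  for \<open>m\<close> tending to 1 from below (lemma \<open>K2_tendsto\<close>); with HOL's \<open>x / 0 = 0\<close> it would be 0.
  Only \<open>0 < M \<le> 1\<close> is meaningful.\<close>

definition K2 :: "real \<Rightarrow> real \<Rightarrow> real \<Rightarrow> real \<Rightarrow> real" where
  "K2 \<mu> p m M =
     (if M = 1 then 1 / (\<mu> * p + 1)
      else if m = 1 then M / (\<mu> * p + 1)
      else M powr m * (Gamma (\<mu> * p + 1) - upper_Gamma (\<mu> * p + 1) (ln (M powr (m - 1))))
             / ln (M powr (m - 1)) powr (\<mu> * p + 1))"

lemma lower_Gamma_bounds:
  fixes s c :: real
  assumes s: "s > 0" and c: "c > 0"
  shows "exp (- c) / s \<le> (Gamma s - upper_Gamma s c) / c powr s"
    and "(Gamma s - upper_Gamma s c) / c powr s \<le> 1 / s"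
proof -
  let ?g = "\<lambda>u::real. exp (- u) * u powr (s - 1)"
  have g_eq: "?g = (\<lambda>u. u powr (s - 1) / exp u)"
    by (simp add: exp_minus divide_inverse mult.commute)
  have full: "(?g has_integral Gamma s) {0..}"
    unfolding g_eq using Gamma_integral_real[OF s] .
  have "?g absolutely_integrable_on {0..}"
    using full by (intro nonnegative_absolutely_integrable_1) auto
  then have abs: "?g absolutely_integrable_on {c..}"
    by (rule set_integrable_subset) (use c in auto)
  have tail: "(?g has_integral upper_Gamma s c) {c..}"
    unfolding upper_Gamma_def using has_integral_set_lebesgue[OF abs] .
  have "?g integrable_on {0..}"
    using full by blast
  then have int: "?g integrable_on {0..c}"
    by (rule integrable_on_subinterval) auto
  have "(?g has_integral (integral {0..c} ?g + upper_Gamma s c)) ({0..c} \<union> {c..})"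
  proof (rule has_integral_Un[OF integrable_integral[OF int] tail])
    have "{0..c} \<inter> {c..} = {c}" using c by auto
    then show "negligible ({0..c} \<inter> {c..})" by simp
  qed
  moreover have "{0..c} \<union> {c..} = {0..}" using c by auto
  ultimately have "(?g has_integral (integral {0..c} ?g + upper_Gamma s c)) {0..}"
    by simp
  from has_integral_unique[OF this full]
  have eq: "Gamma s - upper_Gamma s c = integral {0..c} ?g"
    by linarith
  have pow: "((\<lambda>u. u powr (s - 1)) has_integral c powr s / s) {0..c}"
    using has_integral_powr_from_0[of "s - 1" c] s c by simp
  have "integral {0..c} ?g \<le> c powr s / s"
    by (rule has_integral_le[OF integrable_integral[OF int] pow])
       (auto intro!: mult_left_le_one_le)
  then show "(Gamma s - upper_Gamma s c) / c powr s \<le> 1 / s"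
    using c s by (simp add: eq field_simps)
  have "exp (- c) * (c powr s / s) \<le> integral {0..c} ?g"
    by (rule has_integral_le[OF has_integral_mult_right[OF pow] integrable_integral[OF int]])
       (auto intro!: mult_right_mono)
  then show "exp (- c) / s \<le> (Gamma s - upper_Gamma s c) / c powr s"
    using c s by (simp add: eq field_simps)
qed

lemma K2_tendsto:
  assumes M: "0 < M" "M < 1" and "\<mu> > 0" "p \<ge> 0"
  shows "((\<lambda>m. K2 \<mu> p m M) \<longlongrightarrow> K2 \<mu> p 1 M) (at_left 1)"
proof -
  define s where "s = \<mu> * p + 1"
  have s: "s > 0" using assms by (simp add: s_def add_nonneg_pos)
  let ?c = "\<lambda>m. (m - 1) * ln M"
  let ?F = "\<lambda>m. (Gamma s - upper_Gamma s (?c m)) / ?c m powr s"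
  have cpos: "?c m > 0" if "m < 1" for m
    using that M by (simp add: mult_neg_neg)
  have ev: "eventually (\<lambda>m::real. m < 1) (at_left 1)"
    by (auto simp: eventually_at_filter)
  have lim: "((\<lambda>m. exp (- ?c m) / s) \<longlongrightarrow> exp (- ?c 1) / s) (at_left 1)"
    using s by (intro tendsto_intros) auto
  have "(?F \<longlongrightarrow> 1 / s) (at_left 1)"
  proof (rule tendsto_sandwich)
    show "\<forall>\<^sub>F m in at_left 1. exp (- ?c m) / s \<le> ?F m"
      using ev by eventually_elim (use lower_Gamma_bounds(1)[OF s cpos] in blast)
    show "\<forall>\<^sub>F m in at_left 1. ?F m \<le> 1 / s"
      using ev by eventually_elim (use lower_Gamma_bounds(2)[OF s cpos] in blast)
    show "((\<lambda>m. exp (- ?c m) / s) \<longlongrightarrow> 1 / s) (at_left 1)"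
      using lim by simp
  qed simp
  moreover have "((\<lambda>m. M powr m) \<longlongrightarrow> M powr 1) (at_left 1)"
    using M by (intro tendsto_intros) auto
  ultimately have "((\<lambda>m. M powr m * ?F m) \<longlongrightarrow> M powr 1 * (1 / s)) (at_left 1)"
    by (intro tendsto_mult)
  moreover have "\<forall>\<^sub>F m in at_left 1. M powr m * ?F m = K2 \<mu> p m M"
    using ev by eventually_elim (use M in \<open>auto simp: K2_def s_def ln_powr\<close>)
  ultimately have "((\<lambda>m. K2 \<mu> p m M) \<longlongrightarrow> M powr 1 * (1 / s)) (at_left 1)"
    by (rule Lim_transform_eventually)
  then show ?thesis using M by (simp add: K2_def s_def)
qed

end

theory Submission
  imports Defs
begin

text \<open>On the range of integration, the weight of each Riemann-Liouville integral has total mass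
  \<open>(x - a) powr \<mu> / \<mu>\<close> or \<open>(b - x) powr \<mu> / \<mu>\<close>, so that the left-hand side integrates the
  differences \<open>f x - f t\<close> against these weights. Since \<open>\<bar>f'\<bar> \<le> M powr (1/q)\<close>, these are at most
  \<open>M powr (1/q) * \<bar>x - t\<bar>\<close>, and the beta integral gives the bound with constant
  \<open>M powr (1/q) / (\<mu> + 1)\<close>. It remains to see that this is below the claimed constant:
  \<open>K2 \<ge> M / (\<mu> p + 1)\<close>, and \<open>\<mu> + 1\<close> is the weighted arithmetic mean, with weights \<open>1 - 1/q\<close>
  and \<open>1/q\<close>, of \<open>(\<mu> (q - p) + q - 1) / (q - 1)\<close> and \<open>\<mu> p + 1\<close>, hence at least their weighted
  geometric mean.\<close>

text \<open>The deviation is the integral of \<open>w t * (f x - f t)\<close>, so the pointwise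
  bound can be integrated. Only integrability is asked of \<open>w\<close>, since power weights with
  \<mu> < 1 are unbounded near an end; \<open>w t * f t\<close> stays absolutely integrable because
  \<open>f\<close> is bounded on the compact interval.\<close>

lemma weighted_deviation_le:
  fixes f v w :: "real \<Rightarrow> real"
  assumes cont: "continuous_on {c..d} f"
    and lip: "\<And>t. t \<in> {c..d} \<Longrightarrow> \<bar>f x - f t\<bar> \<le> L * v t"
    and w_nonneg: "\<And>t. t \<in> {c..d} \<Longrightarrow> 0 \<le> w t"
    and W: "(w has_integral W) {c..d}"
    and V: "((\<lambda>t. w t * v t) has_integral V) {c..d}"
  shows "\<bar>W * f x - (LINT t:{c..d}|lebesgue. w t * f t)\<bar> \<le> L * V"
proof -
  have "w absolutely_integrable_on {c..d}"
    using W w_nonneg by (intro nonnegative_absolutely_integrable_1) auto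
  moreover have "f \<in> borel_measurable (lebesgue_on {c..d})"
    using cont by (intro continuous_imp_measurable_on_sets_lebesgue) auto
  moreover have "bounded (f ` {c..d})"
    using cont by (intro compact_imp_bounded compact_continuous_image) auto
  ultimately have "(\<lambda>t. f t * w t) absolutely_integrable_on {c..d}"
    by (intro absolutely_integrable_bounded_measurable_product_real) auto
  then have "(\<lambda>t. w t * f t) absolutely_integrable_on {c..d}"
    by (simp add: mult.commute)
  from has_integral_diff[OF has_integral_mult_left[OF W, of "f x"] has_integral_set_lebesgue[OF this]]
  have dev: "((\<lambda>t. w t * f x - w t * f t) has_integral
      (W * f x - (LINT t:{c..d}|lebesgue. w t * f t))) {c..d}" .
  have bound: "\<bar>w t * f x - w t * f t\<bar> \<le> L * (w t * v t)" if "t \<in> {c..d}" for t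
  proof -
    have "\<bar>w t * f x - w t * f t\<bar> = w t * \<bar>f x - f t\<bar>"
      using w_nonneg[OF that] by (simp add: abs_mult flip: right_diff_distrib)
    also have "\<dots> \<le> w t * (L * v t)"
      using lip[OF that] w_nonneg[OF that] by (rule mult_left_mono)
    finally show ?thesis by (simp add: mult_ac)
  qed
  note LV = has_integral_mult_right[OF V, of L]
  have "W * f x - (LINT t:{c..d}|lebesgue. w t * f t) \<le> L * V"
    by (rule has_integral_le[OF dev LV]) (use bound in \<open>auto simp: abs_le_iff\<close>)
  moreover have "- (W * f x - (LINT t:{c..d}|lebesgue. w t * f t)) \<le> L * V"
    by (rule has_integral_le[OF has_integral_neg[OF dev] LV])
       (use bound in \<open>fastforce simp: abs_le_iff\<close>)
  ultimately show ?thesis by linarith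
qed

text \<open>For negative \<open>r\<close> the integrand is singular at \<open>a\<close>, but the
  antiderivative is continuous there as r + 1 > 0, so differentiability in the interior is
  enough.\<close>

lemma has_integral_powr_left_end:
  fixes a x r :: real
  assumes "a \<le> x" "r > -1"
  shows "((\<lambda>t. (t - a) powr r) has_integral (x - a) powr (r + 1) / (r + 1)) {a..x}"
proof -
  have "((\<lambda>t. (t - a) powr r) has_integral
      (x - a) powr (r + 1) / (r + 1) - (a - a) powr (r + 1) / (r + 1)) {a..x}"
  proof (rule fundamental_theorem_of_calculus_interior)
    show "continuous_on {a..x} (\<lambda>t. (t - a) powr (r + 1) / (r + 1))"
      using assms by (auto intro!: continuous_intros continuous_on_powr')
    fix t assume "t \<in> {a<..<x}"
    then have "((\<lambda>t. (t - a) powr (r + 1) / (r + 1)) has_real_derivative (t - a) powr r) (at t)"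
      using assms by (auto intro!: derivative_eq_intros)
    then show "((\<lambda>t. (t - a) powr (r + 1) / (r + 1)) has_vector_derivative (t - a) powr r) (at t)"
      by (simp add: has_real_derivative_iff_has_vector_derivative)
  qed (use assms in simp)
  then show ?thesis by simp
qed

lemma has_integral_powr_right_end:
  fixes b x r :: real
  assumes "x \<le> b" "r > -1"
  shows "((\<lambda>t. (b - t) powr r) has_integral (b - x) powr (r + 1) / (r + 1)) {x..b}"
proof -
  \<comment> \<open>The reflection of \<open>t\<close> to \<open>- t\<close> makes
    \<open>- b\<close> the left end.\<close>
  have "((\<lambda>t. (- t - (- b)) powr r) has_integral (- x - (- b)) powr (r + 1) / (r + 1)) {- (- x)..- (- b)}"
    using assms by (subst has_integral_reflect_real) (intro has_integral_powr_left_end, auto)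
  then show ?thesis by simp
qed

text \<open>Both fractional integrals are covered at once: \<open>u t\<close> is the distance of
  \<open>t\<close> from the end opposite to \<open>x\<close>, that is \<open>t - a\<close> or
  \<open>b - t\<close>, and \<open>h\<close> is the length of the interval.\<close>

lemma powr_weighted_deviation_le:
  fixes f u :: "real \<Rightarrow> real"
  assumes \<mu>: "\<mu> > 0" and cont: "continuous_on {c..d} f"
    and lip: "\<And>t. t \<in> {c..d} \<Longrightarrow> \<bar>f x - f t\<bar> \<le> L * \<bar>x - t\<bar>"
    and h: "h \<ge> 0"
    and u_nonneg: "\<And>t. t \<in> {c..d} \<Longrightarrow> 0 \<le> u t"
    and u_split: "\<And>t. t \<in> {c..d} \<Longrightarrow> h = u t + \<bar>x - t\<bar>"
    and u_int: "\<And>r. r > -1 \<Longrightarrow> ((\<lambda>t. u t powr r) has_integral h powr (r + 1) / (r + 1)) {c..d}"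
  shows "\<bar>h powr \<mu> * f x - \<mu> * (LINT t:{c..d}|lebesgue. u t powr (\<mu> - 1) * f t)\<bar>
           \<le> L * h powr (\<mu> + 1) / (\<mu> + 1)"
proof -
  let ?w = "\<lambda>t. u t powr (\<mu> - 1)"
  let ?I = "LINT t:{c..d}|lebesgue. ?w t * f t"
  have W: "(?w has_integral h powr \<mu> / \<mu>) {c..d}"
    using u_int[of "\<mu> - 1"] \<mu> by simp
  \<comment> \<open>Writing |x - t| as \<open>h - u t\<close> reduces the beta integral to two power
    integrals.\<close>
  have "((\<lambda>t. ?w t * h - u t powr \<mu>) has_integral
      h powr \<mu> / \<mu> * h - h powr (\<mu> + 1) / (\<mu> + 1)) {c..d}"
    using \<mu> by (intro has_integral_diff has_integral_mult_left W u_int) auto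
  \<comment> \<open>This includes \<open>u t = 0\<close>, where both sides vanish because
    \<open>0 powr r = 0\<close>.\<close>
  moreover have "?w t * h - u t powr \<mu> = ?w t * \<bar>x - t\<bar>" if "t \<in> {c..d}" for t
    using powr_mult_base[of "u t" "\<mu> - 1"] u_nonneg[OF that]
    by (simp add: u_split[OF that] algebra_simps)
  moreover have "h powr \<mu> / \<mu> * h - h powr (\<mu> + 1) / (\<mu> + 1) = h powr (\<mu> + 1) / (\<mu> * (\<mu> + 1))"
    using powr_mult_base[OF h, of \<mu>] \<mu> by (simp add: field_simps)
  ultimately have V: "((\<lambda>t. ?w t * \<bar>x - t\<bar>) has_integral h powr (\<mu> + 1) / (\<mu> * (\<mu> + 1))) {c..d}"
    by (metis (no_types, lifting) has_integral_cong)
  have "\<mu> * \<bar>h powr \<mu> / \<mu> * f x - ?I\<bar> \<le> \<mu> * (L * (h powr (\<mu> + 1) / (\<mu> * (\<mu> + 1))))"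
    using weighted_deviation_le[OF cont lip _ W V] \<mu> by (intro mult_left_mono) auto
  moreover have "\<mu> * \<bar>h powr \<mu> / \<mu> * f x - ?I\<bar> = \<bar>\<mu> * (h powr \<mu> / \<mu> * f x - ?I)\<bar>"
    using \<mu> by (simp add: abs_mult)
  moreover have "\<mu> * (h powr \<mu> / \<mu> * f x - ?I) = h powr \<mu> * f x - \<mu> * ?I"
    using \<mu> by (simp add: right_diff_distrib)
  moreover have "\<mu> * (L * (h powr (\<mu> + 1) / (\<mu> * (\<mu> + 1)))) = L * h powr (\<mu> + 1) / (\<mu> + 1)"
    using \<mu> by simp
  ultimately show ?thesis by simp
qed

text \<open>The functional equation of Gamma turns the normalisation of the Riemann-Liouville
  integrals into the factor \<mu> of \<open>powr_weighted_deviation_le\<close>.\<close>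

lemma Gamma_succ_mult_inverse:
  fixes \<mu> :: real
  assumes "\<mu> > 0"
  shows "Gamma (\<mu> + 1) * (1 / Gamma \<mu> * y) = \<mu> * y"
proof -
  have "\<mu> \<notin> \<int>\<^sub>\<le>\<^sub>0" using assms by (auto simp: nonpos_Ints_def)
  then show ?thesis
    using Gamma_real_pos[OF assms] by (simp add: Gamma_plus1)
qed

lemma RL_minus_deviation_le:
  fixes f :: "real \<Rightarrow> real"
  assumes "a \<le> x" "\<mu> > 0" "continuous_on {a..x} f"
    and "\<And>t. t \<in> {a..x} \<Longrightarrow> \<bar>f x - f t\<bar> \<le> L * \<bar>x - t\<bar>"
  shows "\<bar>(x - a) powr \<mu> * f x - Gamma (\<mu> + 1) * RL_minus \<mu> x f a\<bar>
           \<le> L * (x - a) powr (\<mu> + 1) / (\<mu> + 1)"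
  unfolding RL_minus_def Gamma_succ_mult_inverse[OF assms(2)]
  by (rule powr_weighted_deviation_le)
     (use assms in \<open>auto intro: has_integral_powr_left_end\<close>)

lemma RL_plus_deviation_le:
  fixes f :: "real \<Rightarrow> real"
  assumes "x \<le> b" "\<mu> > 0" "continuous_on {x..b} f"
    and "\<And>t. t \<in> {x..b} \<Longrightarrow> \<bar>f x - f t\<bar> \<le> L * \<bar>x - t\<bar>"
  shows "\<bar>(b - x) powr \<mu> * f x - Gamma (\<mu> + 1) * RL_plus \<mu> x f b\<bar>
           \<le> L * (b - x) powr (\<mu> + 1) / (\<mu> + 1)"
  unfolding RL_plus_def Gamma_succ_mult_inverse[OF assms(2)]
  by (rule powr_weighted_deviation_le)
     (use assms in \<open>auto intro: has_integral_powr_right_end\<close>)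

text \<open>Equality holds if M = 1 or m = 1. Otherwise the lower bound \<open>exp (- c) / s\<close>
  of \<open>lower_Gamma_bounds\<close> applies with c = (m - 1) ln M; here \<open>exp (- c)\<close>
  is \<open>M powr (1 - m)\<close>, which completes \<open>M powr m\<close> to
  \<open>M\<close>.\<close>

lemma K2_ge:
  assumes "0 < M" "M \<le> 1" "m \<le> 1" "\<mu> > 0" "0 \<le> p"
  shows "M / (\<mu> * p + 1) \<le> K2 \<mu> p m M"
proof (cases "M = 1 \<or> m = 1")
  case True
  then show ?thesis by (auto simp: K2_def)
next
  case False
  define s c where "s = \<mu> * p + 1" and "c = (m - 1) * ln M"
  have s: "s > 0" using assms by (simp add: s_def add_nonneg_pos)
  have c: "c > 0" using assms False by (simp add: c_def mult_neg_neg)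
  have "M = M powr m * exp (- c)"
    using assms by (simp add: c_def powr_def algebra_simps flip: exp_add)
  then have "M / s = M powr m * (exp (- c) / s)" by simp
  also have "\<dots> \<le> M powr m * ((Gamma s - upper_Gamma s c) / c powr s)"
    by (intro mult_left_mono lower_Gamma_bounds(1) s c) simp
  also have "\<dots> = K2 \<mu> p m M"
    using assms False by (simp add: K2_def s_def c_def ln_powr)
  finally show ?thesis by (simp add: s_def)
qed

lemma inverse_succ_le_weighted_powr:
  fixes \<mu> p q :: real
  assumes "\<mu> > 0" "q > 1" "0 \<le> p" "p \<le> q"
  shows "1 / (\<mu> + 1)
           \<le> ((q - 1) / (\<mu> * (q - p) + q - 1)) powr ((q - 1) / q) * (1 / (\<mu> * p + 1)) powr (1 / q)"
proof -
  define A B where "A = (\<mu> * (q - p) + q - 1) / (q - 1)" and "B = \<mu> * p + 1"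
  have "\<mu> * (q - p) \<ge> 0" using assms by simp
  then have A: "A > 0"
    using assms unfolding A_def by (intro divide_pos_pos) linarith+
  have B: "B > 0"
    using assms by (simp add: B_def add_nonneg_pos)
  have "A powr ((q - 1) / q) * B powr (1 / q) \<le> (q - 1) / q * A + 1 / q * B"
    using assms A B by (intro Youngs_inequality_0) (auto simp: diff_divide_distrib)
  \<comment> \<open>The weights cancel the denominator of \<open>A\<close>, and the terms with
    \<open>p\<close> cancel: the mean is (\<mu> q + q) / q.\<close>
  also have "\<dots> = \<mu> + 1"
    using assms by (simp add: A_def B_def field_simps)
  finally have "1 / (\<mu> + 1) \<le> 1 / (A powr ((q - 1) / q) * B powr (1 / q))"
    using A B assms by (intro divide_left_mono) auto
  also have "\<dots> = (1 / A) powr ((q - 1) / q) * (1 / B) powr (1 / q)"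
    using A B by (simp add: powr_divide)
  finally show ?thesis by (simp add: A_def B_def)
qed

theorem corollary4:
  fixes f f' :: "real \<Rightarrow> real" and a b m \<mu> p q M x :: real
  assumes "\<And>t. t \<ge> 0 \<Longrightarrow> f t > 0"
    and "\<And>t. t \<ge> 0 \<Longrightarrow> (f has_real_derivative f' t) (at t within {0..})"
    and "0 \<le> a" and "a < b"
    and "0 < m" and "m \<le> 1"
    and "\<mu> > 0" and "q > 1" and "0 \<le> p" and "p \<le> q"
    and "set_integrable lebesgue {a..b} f'"
    and "m_log_convex m (\<lambda>t. \<bar>f' t\<bar> powr q)"
    and "\<And>t. t \<ge> 0 \<Longrightarrow> \<bar>f' t\<bar> powr q \<le> M"
    and "M \<le> 1"
    and "x \<in> {a..b}"
  shows "\<bar>((x - a) powr \<mu> + (b - x) powr \<mu>) / (b - a) * f x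
           - Gamma (\<mu> + 1) / (b - a) * (RL_minus \<mu> x f a + RL_plus \<mu> x f b)\<bar>
         \<le> ((q - 1) / (\<mu> * (q - p) + q - 1)) powr ((q - 1) / q)
             * K2 \<mu> p m M powr (1 / q)
             * (((x - a) powr (\<mu> + 1) + (b - x) powr (\<mu> + 1)) / (b - a))"
proof -
  define L where "L = M powr (1 / q)"
  define H where "H = (x - a) powr (\<mu> + 1) + (b - x) powr (\<mu> + 1)"
  let ?C = "((q - 1) / (\<mu> * (q - p) + q - 1)) powr ((q - 1) / q)"
  let ?K = "K2 \<mu> p m M powr (1 / q)"
  \<comment> \<open>Positivity is part of \<open>m_log_convex\<close>; it forces M > 0, as
    \<open>K2_ge\<close> requires.\<close>
  have "\<bar>f' 0\<bar> powr q > 0"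
    using assms(12) by (simp add: m_log_convex_def)
  with assms(13)[of 0] have M: "M > 0" by linarith
  have "\<bar>f' t\<bar> \<le> L" if "t \<ge> 0" for t
  proof -
    have "\<bar>f' t\<bar> = (\<bar>f' t\<bar> powr q) powr (1 / q)"
      using assms(8) by (simp add: powr_powr)
    also have "\<dots> \<le> L"
      unfolding L_def using assms(8) assms(13)[OF that] by (intro powr_mono2) auto
    finally show ?thesis .
  qed
  \<comment> \<open>The half-line is convex, so the mean value inequality applies with derivatives
    taken within it.\<close>
  then have lip: "\<bar>f x - f t\<bar> \<le> L * \<bar>x - t\<bar>" if "t \<ge> 0" for t
    using field_differentiable_bound[of "{0..}" f f' L x t] assms(2,3,15) that by auto
  have cont: "continuous_on {0..} f"
    using assms(2) by (intro DERIV_continuous_on) auto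
  have "\<bar>(x - a) powr \<mu> * f x - Gamma (\<mu> + 1) * RL_minus \<mu> x f a\<bar>
          \<le> L * (x - a) powr (\<mu> + 1) / (\<mu> + 1)"
    by (rule RL_minus_deviation_le[OF _ _ continuous_on_subset[OF cont] lip]) (use assms in auto)
  moreover have "\<bar>(b - x) powr \<mu> * f x - Gamma (\<mu> + 1) * RL_plus \<mu> x f b\<bar>
          \<le> L * (b - x) powr (\<mu> + 1) / (\<mu> + 1)"
    by (rule RL_plus_deviation_le[OF _ _ continuous_on_subset[OF cont] lip]) (use assms in auto)
  ultimately have "\<bar>((x - a) powr \<mu> + (b - x) powr \<mu>) * f x
      - Gamma (\<mu> + 1) * (RL_minus \<mu> x f a + RL_plus \<mu> x f b)\<bar> \<le> L / (\<mu> + 1) * H"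
    by (simp add: H_def algebra_simps add_divide_distrib)
  also have "\<dots> \<le> ?C * ?K * H"
  proof (rule mult_right_mono)
    \<comment> \<open>The factor \<open>L\<close> is then absorbed into the last power, giving the
      q-th root of M / (\<mu> p + 1), which \<open>K2_ge\<close> compares with
      \<open>?K\<close>.\<close>
    have "L / (\<mu> + 1) \<le> (?C * (1 / (\<mu> * p + 1)) powr (1 / q)) * L"
      using mult_right_mono[OF inverse_succ_le_weighted_powr[OF assms(7-10)], of L]
      by (simp add: L_def)
    also have "\<dots> = ?C * (M / (\<mu> * p + 1)) powr (1 / q)"
      using M assms(7,9) by (simp add: L_def powr_divide add_nonneg_nonneg)
    also have "\<dots> \<le> ?C * ?K"
      using K2_ge[of M m \<mu> p] M assms
      by (intro mult_left_mono powr_mono2) (auto simp: add_nonneg_nonneg)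
    finally show "L / (\<mu> + 1) \<le> ?C * ?K" .
  qed (simp add: H_def)
  finally have "\<bar>((x - a) powr \<mu> + (b - x) powr \<mu>) * f x
      - Gamma (\<mu> + 1) * (RL_minus \<mu> x f a + RL_plus \<mu> x f b)\<bar> / (b - a) \<le> ?C * ?K * H / (b - a)"
    using assms(4) by (intro divide_right_mono) auto
  moreover have "((x - a) powr \<mu> + (b - x) powr \<mu>) / (b - a) * f x
        - Gamma (\<mu> + 1) / (b - a) * (RL_minus \<mu> x f a + RL_plus \<mu> x f b)
      = (((x - a) powr \<mu> + (b - x) powr \<mu>) * f x
        - Gamma (\<mu> + 1) * (RL_minus \<mu> x f a + RL_plus \<mu> x f b)) / (b - a)"
    by (simp add: diff_divide_distrib)
  ultimately show ?thesis
    using assms(4) by (simp add: H_def abs_divide)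
qed

end
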